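(* Let $\frac12<p<1$, and put $\beta=\frac{p}{2p-1}$ and $\gamma=\frac{1-p}{p}$. Let $(d_k)_{k=0}^\infty$ be the unique positive bounded sequence satisfying $$d_0=\frac{1-p}{p},\qquad d_k=\frac{pk\,d_{k-1}+(1-p)k\,d_{k+1}}{k+p}\quad (k\ge 1).$$ Then for all $k\ge 0$, $$d_k=\gamma\int_0^1\frac{t^k(1-t)^{\beta-1}}{(1-\gamma t)^{\beta+1}}\,dt.$$ *)

theory Defs
  imports "HOL-Analysis.Analysis"
begin

definition pos_bounded_solution :: "real \<Rightarrow> (nat \<Rightarrow> real) \<Rightarrow> bool" where
  "pos_bounded_solution p d \<longleftrightarrow>
     (\<forall>k. 0 < d k) \<and> bounded (range d) \<and>
     d 0 = (1 - p) / p \<and>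
     (\<forall>k\<ge>1. d k = (p * real k * d (k - 1) + (1 - p) * real k * d (k + 1)) / (real k + p))"

end

theory Submission
  imports Defs
begin

text \<open>Write \<open>f t = (1 - t) powr (\<beta> - 1) / (1 - \<gamma> * t) powr (\<beta> + 1)\<close> and
  \<open>g t = ((1 - t) / (1 - \<gamma> * t)) powr \<beta>\<close>. Since \<open>\<beta> * (1 - \<gamma>) = 1\<close>, we have \<open>g' = - f\<close>, while
  \<open>(1 - t) * (1 - \<gamma> * t) * f t = g t\<close>. Integrating \<open>t ^ k * f t\<close> by parts therefore gives the
  recurrence for the moments of \<open>f\<close>, and the initial value for \<open>k = 0\<close>. For uniqueness, the
  difference \<open>e\<close> of two solutions has \<open>e 0 = 0\<close> and
  \<open>(1 - p) * (e (k + 1) - e k) = p * (e k - e (k - 1)) + p / k * e k\<close>, so if \<open>e 1 > 0\<close> then the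
  increments of \<open>e\<close> stay above \<open>e 1\<close> and \<open>e\<close> is unbounded.\<close>

section \<open>The weight and its antiderivative\<close>

definition moment_weight :: "real \<Rightarrow> real \<Rightarrow> real \<Rightarrow> real" where
  "moment_weight \<beta> \<gamma> t = (1 - t) powr (\<beta> - 1) / (1 - \<gamma> * t) powr (\<beta> + 1)"

text \<open>When \<open>\<beta> > 1\<close> and \<open>\<beta> * (1 - \<gamma>) = 1\<close>, this is
  the integral of the weight over [t, 1]: it vanishes at 1 and its derivative is minus the
  weight.\<close>

definition weight_tail :: "real \<Rightarrow> real \<Rightarrow> real \<Rightarrow> real" where
  "weight_tail \<beta> \<gamma> t = (1 - t) powr \<beta> / (1 - \<gamma> * t) powr \<beta>"

lemma one_minus_mult_pos:
  fixes \<gamma> t :: real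
  assumes "\<gamma> < 1" and "0 \<le> t" and "t \<le> 1"
  shows "0 < 1 - \<gamma> * t"
proof -
  \<comment> \<open>The sign of \<open>\<gamma>\<close> is left open here;
    \<open>max \<gamma> 0\<close> is nonnegative, as monotonicity of products requires, and still
    below 1.\<close>
  have "\<gamma> * t \<le> max \<gamma> 0 * 1"
    using assms by (intro mult_mono) auto
  then show ?thesis using assms by auto
qed

lemma moment_weight_nonneg: "0 \<le> moment_weight \<beta> \<gamma> t"
  by (simp add: moment_weight_def)

text \<open>As \<open>\<beta> - 1 > 0\<close>, the numerator tends to 0 at \<open>t = 1\<close>, so
  no improper integrals arise.\<close>

lemma continuous_on_moment_weight:
  assumes "1 < \<beta>" and "\<gamma> < 1"
  shows "continuous_on {0..1} (moment_weight \<beta> \<gamma>)"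
  unfolding moment_weight_def
  using assms one_minus_mult_pos[OF assms(2)]
  by (intro continuous_intros continuous_on_powr') (auto simp: less_imp_neq[symmetric] less_imp_le)

lemma continuous_on_weight_tail:
  assumes "1 < \<beta>" and "\<gamma> < 1"
  shows "continuous_on {0..1} (weight_tail \<beta> \<gamma>)"
  unfolding weight_tail_def
  using assms one_minus_mult_pos[OF assms(2)]
  by (intro continuous_intros continuous_on_powr') (auto simp: less_imp_neq[symmetric] less_imp_le)

text \<open>Turns the tail term left by integration by parts back into a combination of
  moments.\<close>

lemma weight_tail_eq:
  assumes "1 < \<beta>" and "\<gamma> < 1" and "t \<in> {0..1}"
  shows "weight_tail \<beta> \<gamma> t = (1 - t) * (1 - \<gamma> * t) * moment_weight \<beta> \<gamma> t"
proof -
  let ?w = "1 - \<gamma> * t"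
  have w: "0 < ?w"
    using one_minus_mult_pos assms by auto
  have "(1 - t) powr \<beta> = (1 - t) * (1 - t) powr (\<beta> - 1)"
    \<comment> \<open>At \<open>t = 1\<close> both sides are 0; elsewhere \<open>1 - t\<close> can
      be divided out.\<close>
    using assms by (cases "t = 1") (auto simp: powr_diff)
  moreover have "?w powr (\<beta> + 1) = ?w powr \<beta> * ?w"
    using w by (simp add: powr_add)
  ultimately show ?thesis
    using w by (simp add: weight_tail_def moment_weight_def)
qed

lemma has_derivative_weight_tail:
  assumes "\<gamma> < 1" and "\<beta> * (1 - \<gamma>) = 1" and "0 < t" and "t < 1"
  shows "(weight_tail \<beta> \<gamma> has_real_derivative - moment_weight \<beta> \<gamma> t) (at t)"
proof -
  let ?w = "1 - \<gamma> * t"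
  have w: "0 < ?w"
    using one_minus_mult_pos assms by auto
  have a: "(1 - t) powr \<beta> = (1 - t) * (1 - t) powr (\<beta> - 1)"
    using assms by (simp add: powr_diff)
  have b: "?w powr \<beta> = ?w * ?w powr (\<beta> - 1)"
    using w by (simp add: powr_diff)
  have c: "?w powr (\<beta> + 1) = ?w * ?w * ?w powr (\<beta> - 1)"
    using w b by (simp add: powr_add)
  \<comment> \<open>With every power reduced to exponent \<open>\<beta> - 1\<close>, the quotient
    rule becomes rational algebra in \<open>A\<close> and \<open>B\<close>.\<close>
  define A B where "A = (1 - t) powr (\<beta> - 1)" and "B = ?w powr (\<beta> - 1)"
  have B: "B > 0"
    using w by (simp add: B_def)
  have key: "((- \<beta> * A) * (?w * B) - ((1 - t) * A) * (- \<gamma> * \<beta> * B)) / ((?w * B) * (?w * B))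
      = - (A / (?w * ?w * B))"
  proof -
    \<comment> \<open>Since \<open>(1 - \<gamma> * t) - \<gamma> * (1 - t) = 1 - \<gamma>\<close>,
      the variable \<open>t\<close> drops out of the bracket.\<close>
    have "(- \<beta> * A) * (?w * B) - ((1 - t) * A) * (- \<gamma> * \<beta> * B) = - (\<beta> * (1 - \<gamma>)) * A * B"
      by (simp add: algebra_simps)
    also have "\<dots> = - A * B"
      by (simp only: assms(2))
    finally have num: "(- \<beta> * A) * (?w * B) - ((1 - t) * A) * (- \<gamma> * \<beta> * B) = - A * B" .
    show ?thesis
      unfolding num using B by simp
  qed
  have "((\<lambda>t. (1 - t) powr \<beta>) has_real_derivative - \<beta> * A) (at t)"
    unfolding A_def using assms
    by (auto intro!: derivative_eq_intros)
  moreover have "((\<lambda>t. (1 - \<gamma> * t) powr \<beta>) has_real_derivative - \<gamma> * \<beta> * B) (at t)"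
    unfolding B_def using w
    by (auto intro!: derivative_eq_intros)
  ultimately have "(weight_tail \<beta> \<gamma> has_real_derivative
      ((- \<beta> * A) * ?w powr \<beta> - (1 - t) powr \<beta> * (- \<gamma> * \<beta> * B)) / (?w powr \<beta> * ?w powr \<beta>)) (at t)"
    unfolding weight_tail_def using w
    by (intro DERIV_divide) auto
  then show ?thesis
    using key by (simp only: a b c moment_weight_def A_def B_def)
qed

section \<open>Moments of the weight\<close>

lemma moment_integrable:
  assumes "1 < \<beta>" and "\<gamma> < 1"
  shows "(\<lambda>t. t ^ k * moment_weight \<beta> \<gamma> t) integrable_on {0..1}"
  by (intro integrable_continuous_real continuous_intros continuous_on_moment_weight assms)

text \<open>The integrand is the derivative of
  \<open>- (t ^ k * weight_tail \<beta> \<gamma> t)\<close>. The tail is 0 at 1 and 1 at 0, so the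
  boundary contributes \<open>0 ^ k\<close>: 1 for \<open>k = 0\<close> and 0 otherwise.\<close>

lemma moment_by_parts:
  assumes "1 < \<beta>" and "\<gamma> < 1" and "\<beta> * (1 - \<gamma>) = 1"
  shows "((\<lambda>t. t ^ k * moment_weight \<beta> \<gamma> t - real k * t ^ (k - 1) * weight_tail \<beta> \<gamma> t)
    has_integral 0 ^ k) {0..1}"
proof -
  have "((\<lambda>t. t ^ k * moment_weight \<beta> \<gamma> t - real k * t ^ (k - 1) * weight_tail \<beta> \<gamma> t)
    has_integral (- (1 ^ k * weight_tail \<beta> \<gamma> 1) - - (0 ^ k * weight_tail \<beta> \<gamma> 0))) {0..1}"
  \<comment> \<open>The derivative of the tail was computed only for \<open>0 < t < 1\<close>;
    continuity handles the endpoints.\<close>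
  proof (rule fundamental_theorem_of_calculus_interior)
    show "continuous_on {0..1} (\<lambda>t. - (t ^ k * weight_tail \<beta> \<gamma> t))"
      by (intro continuous_intros continuous_on_weight_tail assms)
    show "((\<lambda>t. - (t ^ k * weight_tail \<beta> \<gamma> t)) has_vector_derivative
        t ^ k * moment_weight \<beta> \<gamma> t - real k * t ^ (k - 1) * weight_tail \<beta> \<gamma> t) (at t)"
      if "t \<in> {0<..<1}" for t
      unfolding has_real_derivative_iff_has_vector_derivative[symmetric] using that assms
      by (auto intro!: derivative_eq_intros has_derivative_weight_tail simp: algebra_simps)
  qed simp
  then show ?thesis
    by (simp add: weight_tail_def)
qed

lemma moment_zero:
  assumes "1 < \<beta>" and "\<gamma> < 1" and "\<beta> * (1 - \<gamma>) = 1"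
  shows "integral {0..1} (moment_weight \<beta> \<gamma>) = 1"
  using moment_by_parts[OF assms, of 0] by (simp add: integral_unique)

text \<open>Expanding \<open>(1 - t) * (1 - \<gamma> * t) = 1 - (1 + \<gamma>) * t + \<gamma> * t ^
  2\<close> in the by-parts identity gives three consecutive moments; for \<open>k \<ge> 1\<close>
  the boundary term is 0.\<close>

lemma moment_recurrence:
  fixes \<beta> \<gamma> :: real
  defines "M \<equiv> \<lambda>k. integral {0..1} (\<lambda>t. t ^ k * moment_weight \<beta> \<gamma> t)"
  assumes "1 < \<beta>" and "\<gamma> < 1" and "\<beta> * (1 - \<gamma>) = 1" and "k \<ge> 1"
  shows "M k = real k * (M (k - 1) - (1 + \<gamma>) * M k + \<gamma> * M (k + 1))"
proof -
  have M: "((\<lambda>t. t ^ j * moment_weight \<beta> \<gamma> t) has_integral M j) {0..1}" for j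
    unfolding M_def using moment_integrable assms by blast
  obtain j where j: "k = Suc j"
    using assms by (cases k) auto
  have "((\<lambda>t. t ^ k * moment_weight \<beta> \<gamma> t - real k *
      (t ^ (k - 1) * moment_weight \<beta> \<gamma> t - (1 + \<gamma>) * (t ^ k * moment_weight \<beta> \<gamma> t)
        + \<gamma> * (t ^ (k + 1) * moment_weight \<beta> \<gamma> t)))
    has_integral M k - real k * (M (k - 1) - (1 + \<gamma>) * M k + \<gamma> * M (k + 1))) {0..1}"
    by (intro has_integral_diff has_integral_add has_integral_mult_right M)
  moreover have "((\<lambda>t. t ^ k * moment_weight \<beta> \<gamma> t - real k *
      (t ^ (k - 1) * moment_weight \<beta> \<gamma> t - (1 + \<gamma>) * (t ^ k * moment_weight \<beta> \<gamma> t)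
        + \<gamma> * (t ^ (k + 1) * moment_weight \<beta> \<gamma> t))) has_integral 0) {0..1}"
  proof (rule has_integral_eq)
    show "((\<lambda>t. t ^ k * moment_weight \<beta> \<gamma> t - real k * t ^ (k - 1) * weight_tail \<beta> \<gamma> t)
        has_integral 0) {0..1}"
      using moment_by_parts[of \<beta> \<gamma> k] assms by (simp add: j)
  qed (simp add: weight_tail_eq[OF assms(2,3)] j algebra_simps)
  ultimately have "M k - real k * (M (k - 1) - (1 + \<gamma>) * M k + \<gamma> * M (k + 1)) = 0"
    by (rule has_integral_unique)
  then show ?thesis by simp
qed

lemma moment_pos:
  assumes "1 < \<beta>" and "\<gamma> < 1"
  shows "0 < integral {0..1} (\<lambda>t. t ^ k * moment_weight \<beta> \<gamma> t)"
proof -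
  let ?f = "\<lambda>t. t ^ k * moment_weight \<beta> \<gamma> t"
  have nonneg: "0 \<le> ?f t" if "t \<in> {0..1}" for t
    using that by (simp add: moment_weight_nonneg)
  have "continuous_on {0..1} ?f"
    by (intro continuous_intros continuous_on_moment_weight assms)
  moreover have "?f (1/2) \<noteq> 0"
    using one_minus_mult_pos[of \<gamma> "1/2"] assms by (simp add: moment_weight_def)
  ultimately have "integral {0..1} ?f \<noteq> 0"
    using nonneg by (subst integral_eq_0_iff) (auto intro!: bexI[of _ "1/2"])
  moreover have "0 \<le> integral {0..1} ?f"
    using nonneg by (intro integral_nonneg moment_integrable assms)
  ultimately show ?thesis by simp
qed

lemma moment_le:
  assumes "1 < \<beta>" and "\<gamma> < 1"
  shows "integral {0..1} (\<lambda>t. t ^ k * moment_weight \<beta> \<gamma> t) \<le> integral {0..1} (moment_weight \<beta> \<gamma>)"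
proof (rule integral_le)
  show "moment_weight \<beta> \<gamma> integrable_on {0..1}"
    using moment_integrable[OF assms, of 0] by simp
qed (auto intro!: moment_integrable assms mult_left_le_one_le moment_weight_nonneg power_le_one)

text \<open>The recurrence is linear, so the factor \<open>\<gamma>\<close> preserves it; as the
  zeroth moment is 1, this factor is the prescribed initial value.\<close>

lemma pos_bounded_solution_moments:
  assumes "1/2 < p" and "p < 1" and "\<beta> = p / (2 * p - 1)" and "\<gamma> = (1 - p) / p"
  shows "pos_bounded_solution p (\<lambda>k. \<gamma> * integral {0..1} (\<lambda>t. t ^ k * moment_weight \<beta> \<gamma> t))"
proof -
  have \<beta>: "1 < \<beta>" and \<gamma>: "0 < \<gamma>" "\<gamma> < 1" and p\<gamma>: "p * \<gamma> = 1 - p"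
    using assms(1,2) unfolding assms(3,4) by (simp_all add: less_divide_eq divide_less_eq)
  have "1 - \<gamma> = (2 * p - 1) / p"
    using assms(1) unfolding assms(4) by (simp add: field_simps)
  then have \<beta>\<gamma>: "\<beta> * (1 - \<gamma>) = 1"
    using assms(1) unfolding assms(3) by simp
  define M where "M k = integral {0..1} (\<lambda>t. t ^ k * moment_weight \<beta> \<gamma> t)" for k
  have pos: "0 < M k" for k
    unfolding M_def using \<beta> \<gamma>(2) by (rule moment_pos)
  have M0: "M 0 = 1"
    using moment_zero[OF \<beta> \<gamma>(2) \<beta>\<gamma>] by (simp add: M_def)
  have le: "M k \<le> 1" for k
    using moment_le[OF \<beta> \<gamma>(2), of k] moment_zero[OF \<beta> \<gamma>(2) \<beta>\<gamma>] by (simp add: M_def)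
  have rec: "\<gamma> * M k = (p * real k * (\<gamma> * M (k - 1)) + (1 - p) * real k * (\<gamma> * M (k + 1)))
      / (real k + p)" if "k \<ge> 1" for k
  proof -
    \<comment> \<open>Multiplying by \<open>p\<close> matches the coefficients:
      \<open>p * \<gamma> = 1 - p\<close> and \<open>p + p * \<gamma> = 1\<close>.\<close>
    have "p * M k = p * (real k * (M (k - 1) - (1 + \<gamma>) * M k + \<gamma> * M (k + 1)))"
      using moment_recurrence[OF \<beta> \<gamma>(2) \<beta>\<gamma> that] by (simp add: M_def)
    also have "\<dots> = real k * (p * M (k - 1) - (p + p * \<gamma>) * M k + (p * \<gamma>) * M (k + 1))"
      by (simp add: algebra_simps)
    finally have "(real k + p) * M k = p * real k * M (k - 1) + (1 - p) * real k * M (k + 1)"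
      unfolding p\<gamma> by (simp add: algebra_simps)
    then have "(real k + p) * (\<gamma> * M k)
        = p * real k * (\<gamma> * M (k - 1)) + (1 - p) * real k * (\<gamma> * M (k + 1))"
      by (metis (no_types, lifting) distrib_left mult.left_commute)
    moreover have "real k + p > 0"
      using assms by simp
    ultimately show ?thesis
      by (simp add: field_simps)
  qed
  have "\<bar>\<gamma> * M k\<bar> \<le> \<gamma>" for k
    using \<gamma> pos[of k] le[of k] by (simp add: abs_mult)
  then have "bounded (range (\<lambda>k. \<gamma> * M k))"
    by (auto simp: bounded_iff)
  then show ?thesis
    unfolding pos_bounded_solution_def M_def[symmetric]
    using \<gamma>(1) pos M0 assms(4) by (intro conjI allI impI rec mult_pos_pos) auto
qed

section \<open>Uniqueness of the solution\<close>

lemma bounded_recurrence_nonpos: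
  fixes e :: "nat \<Rightarrow> real"
  assumes "1/2 < p" and "p < 1" and "bounded (range e)" and "e 0 = 0"
    and rec: "\<And>k. k \<ge> 1 \<Longrightarrow>
      (real k + p) * e k = p * real k * e (k - 1) + (1 - p) * real k * e (k + 1)"
  shows "e 1 \<le> 0"
proof (rule ccontr)
  assume "\<not> e 1 \<le> 0"
  then have a: "0 < e 1" by simp
  \<comment> \<open>The two bounds feed each other: linear growth makes \<open>e (Suc k)\<close>
    positive, which keeps the next increment large, and that increment continues the growth.\<close>
  have "real (Suc k) * e 1 \<le> e (Suc k) \<and> e 1 \<le> e (Suc k) - e k" for k
  proof (induction k)
    case 0
    then show ?case using assms(4) by simp
  next
    case (Suc k)
    define D where "D = e (Suc (Suc k)) - e (Suc k)"
    have IH: "real (Suc k) * e 1 \<le> e (Suc k)" "e 1 \<le> e (Suc k) - e k"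
      using Suc.IH by auto
    have "0 < real (Suc k) * e 1" using a by simp
    with IH(1) have "0 < e (Suc k)" by linarith
    then have "0 \<le> p * e (Suc k)" using assms by simp
    moreover have "real (Suc k) * ((1 - p) * D) = real (Suc k) * (p * (e (Suc k) - e k)) + p * e (Suc k)"
      using rec[of "Suc k"] by (simp add: D_def algebra_simps)
    ultimately have "real (Suc k) * (p * (e (Suc k) - e k)) \<le> real (Suc k) * ((1 - p) * D)"
      by linarith
    then have "p * (e (Suc k) - e k) \<le> (1 - p) * D"
      by (simp only: mult_le_cancel_left_pos of_nat_0_less_iff zero_less_Suc)
    \<comment> \<open>Here \<open>1/2 < p\<close> enters, as \<open>1 - p \<le> p\<close>: passing
      to the next increment cannot push it below \<open>e 1\<close>.\<close>
    moreover have "(1 - p) * e 1 \<le> p * (e (Suc k) - e k)"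
      using assms IH(2) a by (intro mult_mono) auto
    ultimately have "(1 - p) * e 1 \<le> (1 - p) * D" by linarith
    then have "e 1 \<le> D" using assms by simp
    then show ?case using IH(1) by (simp add: D_def algebra_simps)
  qed
  then have growth: "real (Suc k) * e 1 \<le> e (Suc k)" for k by blast
  obtain B where B: "\<And>k. \<bar>e k\<bar> \<le> B"
    using assms(3) by (auto simp: bounded_iff)
  obtain n where "B < real n * e 1"
    using reals_Archimedean3[OF a] by blast
  also have "\<dots> \<le> real (Suc n) * e 1"
    using a by simp
  also have "\<dots> \<le> B"
    using growth[of n] B[of "Suc n"] by linarith
  finally show False by simp
qed

lemma pos_bounded_solution_unique:
  assumes "1/2 < p" and "p < 1"
    and "pos_bounded_solution p c" and "pos_bounded_solution p d"
  shows "c = d"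
proof -
  have rec: "(real k + p) * x k = p * real k * x (k - 1) + (1 - p) * real k * x (k + 1)"
    if "pos_bounded_solution p x" and "k \<ge> 1" for x k
  proof -
    have "real k + p \<noteq> 0" using assms(1) by simp
    with that show ?thesis
      unfolding pos_bounded_solution_def by (metis nonzero_mult_div_cancel_left times_divide_eq_right)
  qed
  \<comment> \<open>Stated for arbitrary \<open>x\<close> and \<open>y\<close> so that both orders
    of \<open>c\<close> and \<open>d\<close> can be used, forcing \<open>c 1 = d 1\<close>.\<close>
  have nonpos: "x 1 - y 1 \<le> 0"
    if x: "pos_bounded_solution p x" and y: "pos_bounded_solution p y" for x y
  proof (rule bounded_recurrence_nonpos[OF assms(1,2), of "\<lambda>k. x k - y k"])
    show "bounded (range (\<lambda>k. x k - y k))"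
      using x y by (intro bounded_minus_comp) (auto simp: pos_bounded_solution_def)
    show "x 0 - y 0 = 0"
      using x y by (simp add: pos_bounded_solution_def)
    show "(real k + p) * (x k - y k)
        = p * real k * (x (k - 1) - y (k - 1)) + (1 - p) * real k * (x (k + 1) - y (k + 1))"
      if "k \<ge> 1" for k
      using rec[OF x that] rec[OF y that] by (simp only: right_diff_distrib)
  qed
  have start: "c 0 = d 0"
    using assms(3,4) unfolding pos_bounded_solution_def by argo
  \<comment> \<open>The recurrence has order two, so two consecutive values are carried along; the
    coefficient \<open>(1 - p) * real (Suc k)\<close> of the next one is nonzero.\<close>
  have "c k = d k \<and> c (Suc k) = d (Suc k)" for k
  proof (induction k)
    case 0
    then show ?case
      using nonpos[OF assms(3,4)] nonpos[OF assms(4,3)] start by simp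
  next
    case (Suc k)
    have "(1 - p) * real (Suc k) * c (Suc (Suc k)) = (1 - p) * real (Suc k) * d (Suc (Suc k))"
      using rec[OF assms(3), of "Suc k"] rec[OF assms(4), of "Suc k"] Suc.IH by simp
    then show ?case using Suc.IH assms(2) by simp
  qed
  then show ?thesis by auto
qed

theorem theorem4p1:
  fixes p \<beta> \<gamma> :: real
  assumes "1/2 < p" and "p < 1"
    and "\<beta> = p / (2 * p - 1)"
    and "\<gamma> = (1 - p) / p"
  shows "(\<exists>!d. pos_bounded_solution p d) \<and>
    (\<forall>d. pos_bounded_solution p d \<longrightarrow>
      (\<forall>k. d k = \<gamma> * integral {0..1}
         (\<lambda>t. t ^ k * (1 - t) powr (\<beta> - 1) / (1 - \<gamma> * t) powr (\<beta> + 1))))"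
proof -
  have sol: "pos_bounded_solution p (\<lambda>k. \<gamma> * integral {0..1}
      (\<lambda>t. t ^ k * (1 - t) powr (\<beta> - 1) / (1 - \<gamma> * t) powr (\<beta> + 1)))"
    using pos_bounded_solution_moments[OF assms] by (simp add: moment_weight_def)
  have unique: "c = d" if "pos_bounded_solution p c" and "pos_bounded_solution p d" for c d
    using pos_bounded_solution_unique[OF assms(1,2) that] .
  show ?thesis
    using sol unique by (metis (no_types, lifting))
qed

end
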